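(* Let $B\ge2$ be an integer, let $C=\frac{1}{1-(1-1/B)^B}$, and suppose $0\le\delta\le\left(\frac{B-1}{B}\right)^{B-1}\frac{(1-(1-1/B)^B)^{-1}}{B}$. Then the optimal $\mathrm{CVaR}_\delta$-competitive ratio for discrete-time ski rental with buying cost $B$ is $$\alpha_\delta^{B,*}=\frac{C-\delta}{1-\delta},$$ and the optimal strategy is the distribution $\vec p$ on $\{1,\dots,B\}$ given by $p_i=\frac{C}{B}\left(1-\frac1B\right)^{B-i}$ for $i\in\{1,\dots,B\}$. In particular the optimal strategy does not depend on $\delta$ in this range and coincides with the optimal strategy for $\delta=0$ (expected cost).
   Context: Conditional value-at-risk (loss convention): for a real random variable $Y$ and $\delta\in[0,1)$, $\mathrm{CVaR}_\delta[Y]=\inf_{t\in\mathbb{R}}\{t+\frac{1}{1-\delta}\mathbb{E}[(Y-t)^+]\}=\frac{1}{1-\delta}\int_\delta^1F_Y^{-1}(p)\,dp$. Discrete-time ski rental with integer buying cost $B\ge2$: a strategy is a probability distribution on $\mathbb{N}=\{1,2,\dots\}$ of the purchase day $X$; if the adversary chooses season length $s\in\mathbb{N}$, the cost is $s\cdot\mathbb{1}_{X>s}+(B+X-1)\cdot\mathbb{1}_{X\le s}$. The $\mathrm{CVaR}_\delta$-competitive ratio of a strategy is $\sup_{s\in\mathbb{N}}\mathrm{CVaR}_\delta[s\cdot\mathbb{1}_{X>s}+(B+X-1)\cdot\mathbb{1}_{X\le s}]/\min\{s,B\}$, and $\alpha_\delta^{B,*}$ is the infimum of this quantity over all strategies.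
   Formalization: Uniqueness of the optimal strategy is claimed except when B=2 and δ equals its upper bound 1/3, where it fails: buying on day 2 with certainty also attains the ratio 3/2. The value formula and the optimality of p hold on the whole range. *)

theory Defs
  imports "HOL-Probability.Probability"
begin

(* Loss convention, 0 <= d < 1. For integrable Y the infimum is over a set bounded below by the
   mean of Y; the Bochner integral makes the definition meaningful only for integrable Y.
   All costs below are bounded for a fixed season length. *)
definition cvar :: "real \<Rightarrow> 'a measure \<Rightarrow> ('a \<Rightarrow> real) \<Rightarrow> real" where
  "cvar \<delta> M Y = (INF t::real. t + 1 / (1 - \<delta>) * (LINT x|M. max (Y x - t) 0))"

definition ski_strategies :: "nat pmf set" where
  "ski_strategies = {q. set_pmf q \<subseteq> {1..}}"

definition ski_cost :: "nat \<Rightarrow> nat \<Rightarrow> nat \<Rightarrow> real" where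
  "ski_cost B s x =
     real s * of_bool (x > s) + (real B + real x - 1) * of_bool (x \<le> s)"

(* Extended reals, because the supremum over seasons is infinite for heavy-tailed strategies. *)
definition cvar_ratio :: "nat \<Rightarrow> real \<Rightarrow> nat pmf \<Rightarrow> ereal" where
  "cvar_ratio B \<delta> q =
     (SUP s\<in>{1::nat..}. ereal (cvar \<delta> (measure_pmf q) (ski_cost B s) / real (min s B)))"

definition opt_cvar_ratio :: "nat \<Rightarrow> real \<Rightarrow> ereal" where
  "opt_cvar_ratio B \<delta> = (INF q\<in>ski_strategies. cvar_ratio B \<delta> q)"

definition optimal_strategy :: "nat \<Rightarrow> real \<Rightarrow> nat pmf \<Rightarrow> bool" where
  "optimal_strategy B \<delta> q \<longleftrightarrow>
     q \<in> ski_strategies \<and> cvar_ratio B \<delta> q = opt_cvar_ratio B \<delta>"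

end

theory Submission
  imports Defs
begin

text \<open>Write \<open>T j\<close> and \<open>t j\<close> for the tails \<open>P(X > j)\<close> under a competitor \<open>q\<close> and under \<open>p\<close>. For every
  season \<open>s\<close> the day-1 atom of \<open>p\<close> is at most the mass on which \<open>p\<close> attains its least cost \<open>min s B\<close>,
  so discarding the best \<open>\<delta>\<close>-fraction turns the expected cost \<open>C * min s B\<close> into
  \<open>(C - \<delta>) * min s B\<close>. Conversely, summation by parts expresses the difference of the expected excess
  costs of \<open>q\<close> and \<open>p\<close> over a threshold through the differences \<open>T j - t j\<close>. If \<open>q\<close> is at least as good as
  \<open>p\<close>, the seasons \<open>m < B\<close> force \<open>T m \<ge> t m\<close> by induction on \<open>m\<close>; a season beyond \<open>B\<close> then punishes
  late purchases and forces equality.\<close>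

section \<open>Tail probabilities and summation by parts for expectations\<close>

definition tail :: "nat pmf \<Rightarrow> nat \<Rightarrow> real" where
  "tail q j = measure_pmf.prob q {j<..}"

lemma pmf_Suc_eq_tail_diff: "pmf q (Suc i) = tail q i - tail q (Suc i)"
proof -
  have "{i<..} = {Suc i} \<union> {Suc i<..}" by auto
  moreover have "measure_pmf.prob q ({Suc i} \<union> {Suc i<..}) =
      measure_pmf.prob q {Suc i} + measure_pmf.prob q {Suc i<..}"
    by (rule measure_pmf.finite_measure_Union) auto
  ultimately have "tail q i = measure_pmf.prob q {Suc i} + tail q (Suc i)"
    unfolding tail_def by metis
  then show ?thesis by (simp add: measure_pmf_single)
qed

lemma tail_nonneg: "0 \<le> tail q j"
  by (simp add: tail_def)

lemma tail_antimono: "i \<le> j \<Longrightarrow> tail q j \<le> tail q i"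
  unfolding tail_def by (intro measure_pmf.finite_measure_mono) auto

lemma pmf_0_ski_strategies: "q \<in> ski_strategies \<Longrightarrow> pmf q 0 = 0"
  by (force simp: ski_strategies_def pmf_eq_0_set_pmf)

text \<open>Differences of tails give the atoms on positive days, and a strategy has no mass at
  0.\<close>

lemma ski_strategies_eqI:
  assumes "p \<in> ski_strategies" "q \<in> ski_strategies" "\<And>j. tail p j = tail q j"
  shows "p = q"
proof (rule pmf_eqI)
  fix i show "pmf p i = pmf q i"
    using assms by (cases i) (simp_all add: pmf_Suc_eq_tail_diff pmf_0_ski_strategies)
qed

text \<open>The indicators keep the increments before day \<open>x\<close>, so the sum telescopes up
  to \<open>min x (Suc N)\<close>, after which \<open>f\<close> is constant.\<close>

lemma sum_increments_eq:
  fixes f :: "nat \<Rightarrow> real"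
  assumes const: "\<And>x. N < x \<Longrightarrow> f x = f (Suc N)" and "1 \<le> x"
  shows "f 1 + (\<Sum>j=1..N. indicator {j<..} x * (f (Suc j) - f j)) = f x"
proof -
  let ?k = "min x (Suc N)"
  have "(\<Sum>j=1..N. indicator {j<..} x * (f (Suc j) - f j)) = (\<Sum>j=1..<?k. f (Suc j) - f j)"
    by (rule sum.mono_neutral_cong_right) (auto simp: indicator_def)
  also have "\<dots> = f ?k - f 1"
    using \<open>1 \<le> x\<close> by (intro sum_Suc_diff') auto
  also have "f ?k = f x"
    using const[of x] by (cases "x \<le> Suc N") (auto simp: min_def)
  finally show ?thesis by simp
qed

lemma integrable_pmf_bounded:
  fixes f :: "nat \<Rightarrow> real"
  assumes "\<And>x. \<bar>f x\<bar> \<le> K"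
  shows "integrable (measure_pmf q) f"
  by (rule measure_pmf.integrable_const_bound[where B = K]) (use assms in auto)

lemma integrable_pmf_indicator: "integrable (measure_pmf q) (indicator A :: nat \<Rightarrow> real)"
  by (rule integrable_pmf_bounded[where K = 1]) (simp add: indicator_def)

text \<open>Serves to bound \<open>max (f x - t) 0\<close> from below in expectation: dropping the
  maximum loses something only where \<open>f x < t\<close>, and the indicators give part of it
  back.\<close>

lemma
  fixes f :: "nat \<Rightarrow> real"
  assumes f: "integrable (measure_pmf q) f"
  shows integrable_add_indicators:
      "integrable (measure_pmf q) (\<lambda>x. f x - t + a * indicator A x + b * indicator A' x)" (is ?I)
    and expectation_add_indicators:
      "measure_pmf.expectation q (\<lambda>x. f x - t + a * indicator A x + b * indicator A' x) =
        measure_pmf.expectation q f - t + a * measure_pmf.prob q A + b * measure_pmf.prob q A'" (is ?E)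
proof -
  have ind: "integrable (measure_pmf q) (\<lambda>x. c * indicator S x :: real)" for c and S :: "nat set"
    by (intro integrable_mult_right integrable_pmf_indicator)
  have 1: "integrable (measure_pmf q) (\<lambda>x. f x - t)"
    using f by (intro Bochner_Integration.integrable_diff) auto
  have 2: "integrable (measure_pmf q) (\<lambda>x. f x - t + a * indicator A x)"
    by (intro Bochner_Integration.integrable_add 1 ind)
  show ?I
    by (intro Bochner_Integration.integrable_add 2 ind)
  show ?E
    unfolding Bochner_Integration.integral_add[OF 2 ind] Bochner_Integration.integral_add[OF 1 ind]
    using f by simp
qed

text \<open>Integrates the telescoped form of \<open>f\<close>, each indicator turning into a tail.
  Costs of a fixed season are eventually constant, so a finite sum suffices.\<close>

lemma expectation_eq_sum_tail:
  fixes f :: "nat \<Rightarrow> real"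
  assumes q: "q \<in> ski_strategies" and const: "\<And>x. N < x \<Longrightarrow> f x = f (Suc N)"
  shows "measure_pmf.expectation q f = f 1 + (\<Sum>j=1..N. tail q j * (f (Suc j) - f j))"
proof -
  have "measure_pmf.expectation q f =
      measure_pmf.expectation q (\<lambda>x. f 1 + (\<Sum>j=1..N. indicator {j<..} x * (f (Suc j) - f j)))"
    using q sum_increments_eq[of N f, OF const]
    by (intro integral_cong_AE) (auto simp: AE_measure_pmf_iff ski_strategies_def)
  also have "\<dots> = measure_pmf.expectation q (\<lambda>x. f 1) +
      measure_pmf.expectation q (\<lambda>x. \<Sum>j=1..N. indicator {j<..} x * (f (Suc j) - f j))"
    by (intro Bochner_Integration.integral_add Bochner_Integration.integrable_sum
        integrable_mult_left integrable_pmf_indicator measure_pmf.integrable_const)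
  also have "measure_pmf.expectation q (\<lambda>x. \<Sum>j=1..N. indicator {j<..} x * (f (Suc j) - f j)) =
      (\<Sum>j=1..N. measure_pmf.expectation q (\<lambda>x. indicator {j<..} x * (f (Suc j) - f j)))"
    by (intro Bochner_Integration.integral_sum integrable_mult_left integrable_pmf_indicator)
  also have "\<dots> = (\<Sum>j=1..N. tail q j * (f (Suc j) - f j))"
    by (simp add: tail_def del: of_bool_eq indicator_simps)
  also have "measure_pmf.expectation q (\<lambda>x. f 1) = f 1"
    by simp
  finally show ?thesis .
qed

lemma expectation_diff_eq_sum_tail:
  fixes f :: "nat \<Rightarrow> real"
  assumes "q \<in> ski_strategies" "p \<in> ski_strategies" "\<And>x. N < x \<Longrightarrow> f x = f (Suc N)"
  shows "measure_pmf.expectation q f - measure_pmf.expectation p f =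
    (\<Sum>j=1..N. (tail q j - tail p j) * (f (Suc j) - f j))"
  using expectation_eq_sum_tail[where f = f and N = N, OF assms(1,3)]
    expectation_eq_sum_tail[where f = f and N = N, OF assms(2,3)]
  by (simp add: left_diff_distrib sum_subtractf)

section \<open>Bounds for the cost and estimates for CVaR\<close>

lemma ski_cost_eq: "ski_cost B s x = (if x \<le> s then real B + real x - 1 else real s)"
  by (simp add: ski_cost_def)

lemma ski_cost_nonneg: "1 \<le> B \<Longrightarrow> 0 \<le> ski_cost B s x"
  by (simp add: ski_cost_eq)

lemma ski_cost_le: "ski_cost B s x \<le> real B + real s"
  by (simp add: ski_cost_eq)

lemma integrable_ski_cost:
  assumes "1 \<le> B"
  shows "integrable (measure_pmf q) (ski_cost B s)"
    "integrable (measure_pmf q) (\<lambda>x. max (ski_cost B s x - t) 0)"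
proof -
  have "\<bar>ski_cost B s x\<bar> \<le> real B + real s" for x
    using ski_cost_nonneg[OF assms, of s x] ski_cost_le[of B s x] by linarith
  then show "integrable (measure_pmf q) (ski_cost B s)"
    by (rule integrable_pmf_bounded)
  have "\<bar>max (ski_cost B s x - t) 0\<bar> \<le> real B + real s + \<bar>t\<bar>" for x
    using ski_cost_nonneg[OF assms, of s x] ski_cost_le[of B s x] by linarith
  then show "integrable (measure_pmf q) (\<lambda>x. max (ski_cost B s x - t) 0)"
    by (rule integrable_pmf_bounded)
qed

text \<open>Clearing the factor \<open>1 / (1 - \<delta>)\<close> leaves one inequality per
  threshold \<open>t\<close>, the form in which lower bounds are proved below.\<close>

lemma cvar_geI:
  assumes "\<delta> < 1" and "\<And>t. c \<le> (1 - \<delta>) * t + (LINT x|M. max (Y x - t) 0)"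
  shows "c / (1 - \<delta>) \<le> cvar \<delta> M Y"
  unfolding cvar_def
proof (rule cINF_greatest)
  fix t
  have "c / (1 - \<delta>) \<le> ((1 - \<delta>) * t + (LINT x|M. max (Y x - t) 0)) / (1 - \<delta>)"
    using assms by (intro divide_right_mono) auto
  also have "\<dots> = t + 1 / (1 - \<delta>) * (LINT x|M. max (Y x - t) 0)"
    using assms(1) by (simp add: field_simps)
  finally show "c / (1 - \<delta>) \<le> t + 1 / (1 - \<delta>) * (LINT x|M. max (Y x - t) 0)" .
qed simp

text \<open>A real infimum is guaranteed to lie below its elements only for sets bounded below. Here
  0 is a bound: the expected excess is at least \<open>- t\<close>, and its factor is at least
  1.\<close>

lemma cvar_le:
  fixes q :: "nat pmf"
  assumes "0 \<le> \<delta>" "\<delta> < 1" and nonneg: "\<And>x. 0 \<le> Y x" and Y: "integrable (measure_pmf q) Y"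
  shows "cvar \<delta> (measure_pmf q) Y \<le> t + 1 / (1 - \<delta>) * (LINT x|measure_pmf q. max (Y x - t) 0)"
  unfolding cvar_def
proof (rule cINF_lower)
  show "bdd_below (range (\<lambda>t. t + 1 / (1 - \<delta>) * (LINT x|measure_pmf q. max (Y x - t) 0)))"
  proof (rule bdd_belowI2)
    fix t
    let ?I = "LINT x|measure_pmf q. max (Y x - t) 0"
    have int: "integrable (measure_pmf q) (\<lambda>x. max (Y x - t) 0)"
      using Y by (intro integrable_max) auto
    have "(LINT x|measure_pmf q. - t) \<le> ?I"
      using int nonneg by (intro integral_mono) (auto simp: max.coboundedI1)
    then have "- t \<le> ?I" by simp
    also have "?I \<le> 1 / (1 - \<delta>) * ?I"
      using assms(1,2) mult_right_mono[of 1 "1 / (1 - \<delta>)" ?I] by simp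
    finally show "0 \<le> t + 1 / (1 - \<delta>) * ?I" by simp
  qed
qed simp

section \<open>The strategy \<open>p\<close>: tails, expected costs and CVaR ratio\<close>

locale ski_rental =
  fixes B :: nat and C :: real and p :: "nat pmf"
  assumes B_ge_2: "2 \<le> B"
    and C_eq: "C = 1 / (1 - (1 - 1 / real B) ^ B)"
    and pmf_p: "\<And>i. pmf p i = (if i \<in> {1..B} then C / real B * (1 - 1 / real B) ^ (B - i) else 0)"
begin

abbreviation "r \<equiv> 1 - 1 / real B"

lemma r_pos: "0 < r" and r_less_1: "r < 1" and B_times_r: "real B * r = real B - 1"
  using B_ge_2 by (simp_all add: field_simps)

lemma r_power_B_less_1: "r ^ B < 1"
  using r_pos r_less_1 B_ge_2 by (simp add: power_less_one_iff)

lemma C_pos: "0 < C"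
  using r_power_B_less_1 by (simp add: C_eq)

lemma C_times: "C * (1 - r ^ B) = 1"
  using r_power_B_less_1 by (simp add: C_eq)

lemma p_in_ski_strategies: "p \<in> ski_strategies"
  using pmf_p by (force simp: ski_strategies_def set_pmf_eq)

text \<open>A partial geometric sum, built from the last day backwards. Truncated subtraction yields
  0 for \<open>j \<ge> B\<close>.\<close>

lemma tail_p: "tail p j = C * (1 - r ^ (B - j))"
proof (induction "B - j" arbitrary: j)
  case 0
  then have "set_pmf p \<inter> {j<..} = {}"
    using pmf_p by (auto simp: set_pmf_eq)
  then have "tail p j = 0"
    unfolding tail_def by (simp add: measure_pmf_zero_iff)
  with 0 show ?case by simp
next
  case (Suc n)
  then have j: "j < B" "B - Suc j = n" "B - j = Suc n" by auto
  have "tail p j = pmf p (Suc j) + tail p (Suc j)"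
    by (simp add: pmf_Suc_eq_tail_diff)
  also have "\<dots> = C / real B * r ^ n + C * (1 - r ^ n)"
    using Suc(1)[of "Suc j"] j pmf_p[of "Suc j"] by simp
  also have "\<dots> = C * (1 - r ^ Suc n)"
    by (simp add: algebra_simps)
  finally show ?case using j by simp
qed

text \<open>The equalizing property of \<open>p\<close>: for \<open>j \<ge> 1\<close>, lengthening
  the season from \<open>j\<close> to \<open>Suc j\<close> adds exactly \<open>C\<close> to the
  expected cost; for \<open>j = 0\<close> this is the expected cost of season 1.\<close>

lemma tail_p_recursion:
  assumes "j < B"
  shows "real B * tail p j - (real B - 1) * tail p (Suc j) = C"
proof -
  have "B - j = Suc (B - Suc j)" using assms by simp
  then have "real B * tail p j - (real B - 1) * tail p (Suc j) =
      real B * (C * (1 - r * r ^ (B - Suc j))) - real B * r * (C * (1 - r ^ (B - Suc j)))"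
    by (simp only: tail_p B_times_r power_Suc)
  also have "\<dots> = C * (real B * (1 - r))" by algebra
  also have "\<dots> = C" using B_ge_2 by simp
  finally show ?thesis .
qed

lemma tail_p_0: "tail p 0 = 1"
  by (simp add: tail_p C_times)

lemma tail_p_eq_0: "B \<le> j \<Longrightarrow> tail p j = 0"
  by (simp add: tail_p)

text \<open>The left side is the expected cost of \<open>p\<close> in season \<open>s\<close> after
  summation by parts. It grows by \<open>C\<close> per day up to \<open>B\<close>, where the tails
  vanish.\<close>

lemma sum_tail_p:
  "1 \<le> s \<Longrightarrow> real B + (\<Sum>j=1..<s. tail p j) - (real B - 1) * tail p s = C * real (min s B)"
proof (induction s rule: nat_induct_at_least)
  case base
  then show ?case using tail_p_recursion[of 0] tail_p_0 B_ge_2 by simp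
next
  case (Suc s)
  show ?case
  proof (cases "s < B")
    case True
    then show ?thesis
      using Suc tail_p_recursion[of s] by (simp add: algebra_simps)
  next
    case False
    then show ?thesis using Suc by (simp add: tail_p_eq_0)
  qed
qed

lemma expectation_p_ski_cost:
  assumes "1 \<le> s"
  shows "measure_pmf.expectation p (ski_cost B s) = C * real (min s B)"
proof -
  have "measure_pmf.expectation p (ski_cost B s) =
      ski_cost B s 1 + (\<Sum>j=1..s. tail p j * (ski_cost B s (Suc j) - ski_cost B s j))"
    by (rule expectation_eq_sum_tail[OF p_in_ski_strategies]) (simp add: ski_cost_eq)
  also have "{1..s} = insert s {1..<s}" using assms by auto
  \<comment> \<open>The cost rises by 1 per day before \<open>s\<close> and drops by
    \<open>B - 1\<close> right after day \<open>s\<close>.\<close>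
  also have "(\<Sum>j\<in>insert s {1..<s}. tail p j * (ski_cost B s (Suc j) - ski_cost B s j)) =
      (\<Sum>j=1..<s. tail p j) - (real B - 1) * tail p s"
    using assms by (simp add: ski_cost_eq algebra_simps)
  also have "ski_cost B s 1 = real B"
    using assms by (simp add: ski_cost_eq)
  finally show ?thesis
    using sum_tail_p[OF assms] by linarith
qed

text \<open>The atoms of \<open>p\<close> grow geometrically, and every tail with
  \<open>j < B\<close> contains the largest one, at day \<open>B\<close>. This supplies
  \<open>\<delta> < 1\<close> and the slack \<open>tail p m - \<delta>\<close> in short
  seasons.\<close>

lemma pmf_p_1_less_tail_p:
  assumes "j < B"
  shows "pmf p 1 < tail p j"
proof -
  have "pmf p 1 = C / real B * r ^ (B - 1)"
    using pmf_p[of 1] B_ge_2 by simp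
  also have "\<dots> < C / real B * 1"
    using C_pos B_ge_2 r_pos r_less_1
    by (intro mult_strict_left_mono) (simp_all add: power_less_one_iff)
  also have "\<dots> = tail p (B - 1)"
    using B_ge_2 by (simp add: tail_p)
  also have "\<dots> \<le> tail p j"
    using assms by (intro tail_antimono) simp
  finally show ?thesis .
qed

lemma pmf_p_1_less_1: "pmf p 1 < 1"
  using pmf_p_1_less_tail_p[of 0] B_ge_2 by (simp add: tail_p_0)

text \<open>No cost from day 1 on is below the threshold \<open>min s B\<close>, so the positive
  part disappears and only the expected cost remains.\<close>

lemma cvar_ratio_p_le:
  assumes \<delta>: "0 \<le> \<delta>" "\<delta> \<le> pmf p 1"
  shows "cvar_ratio B \<delta> p \<le> ereal ((C - \<delta>) / (1 - \<delta>))"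
  unfolding cvar_ratio_def
proof (rule SUP_least)
  fix s :: nat assume "s \<in> {1..}"
  then have s: "1 \<le> s" by simp
  let ?m = "real (min s B)"
  have \<delta>1: "\<delta> < 1" using \<delta> pmf_p_1_less_1 by simp
  have "cvar \<delta> p (ski_cost B s) \<le>
      ?m + 1 / (1 - \<delta>) * (LINT x|measure_pmf p. max (ski_cost B s x - ?m) 0)"
    using B_ge_2 by (intro cvar_le \<delta> \<delta>1 ski_cost_nonneg integrable_ski_cost) auto
  also have "(LINT x|measure_pmf p. max (ski_cost B s x - ?m) 0) =
      (LINT x|measure_pmf p. ski_cost B s x - ?m)"
    using p_in_ski_strategies
    by (intro integral_cong_AE) (auto simp: AE_measure_pmf_iff ski_strategies_def ski_cost_eq max_def
        split: if_splits)
  also have "\<dots> = C * ?m - ?m"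
    using B_ge_2 expectation_p_ski_cost[OF s] integrable_ski_cost(1)[of B p s] by simp
  also have "?m + 1 / (1 - \<delta>) * (C * ?m - ?m) = (C - \<delta>) / (1 - \<delta>) * ?m"
    using \<delta>1 by (simp add: field_simps)
  finally show "ereal (cvar \<delta> p (ski_cost B s) / ?m) \<le> ereal ((C - \<delta>) / (1 - \<delta>))"
    using s B_ge_2 by (simp add: divide_le_eq)
qed

section \<open>Lower bounds for competing strategies\<close>

text \<open>The gap to \<open>p\<close> is uniform in \<open>t\<close>: the increment of the cost excess between days \<open>i\<close> and
  \<open>i + 1\<close> vanishes only for large \<open>t\<close>, and there the mass of \<open>p\<close> beyond \<open>m\<close>, which is
  more than \<open>\<delta>\<close>, takes over.\<close>

lemma cvar_ski_cost_greater:
  assumes \<delta>: "0 \<le> \<delta>" "\<delta> \<le> pmf p 1" and q: "q \<in> ski_strategies" and m: "m < B"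
    and ge: "\<And>j. 1 \<le> j \<Longrightarrow> j < m \<Longrightarrow> tail p j \<le> tail q j" and le: "tail q m \<le> tail p m"
    and i: "1 \<le> i" "i \<le> m" "tail q i \<noteq> tail p i"
  shows "(C - \<delta>) / (1 - \<delta>) * real m < cvar \<delta> q (ski_cost B m)"
proof -
  define \<epsilon> where "\<epsilon> = min (tail p m - \<delta>) \<bar>tail q i - tail p i\<bar>"
  have \<epsilon>: "0 < \<epsilon>" "\<epsilon> \<le> tail p m - \<delta>" "\<epsilon> \<le> \<bar>tail q i - tail p i\<bar>"
    using i \<delta> pmf_p_1_less_tail_p[OF m] by (auto simp: \<epsilon>_def)
  have \<delta>1: "\<delta> < 1" using \<delta> pmf_p_1_less_1 by simp
  have B: "1 \<le> B" using B_ge_2 by simp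
  have m1: "1 \<le> m" using i by simp
  have "(C - \<delta>) * real m + \<epsilon> \<le>
      (1 - \<delta>) * t + (LINT x|measure_pmf q. max (ski_cost B m x - t) 0)" for t
  proof -
    let ?f = "\<lambda>x. max (ski_cost B m x - t) 0"
    let ?d = "\<lambda>j. (tail q j - tail p j) * (?f (Suc j) - ?f j)"
    have incr: "?f j \<le> ?f (Suc j)" if "j < m" for j
      using that by (simp add: ski_cost_eq)
    have decr: "?f (Suc m) \<le> ?f m"
      using m by (simp add: ski_cost_eq)
    have nonneg: "0 \<le> ?d j" if "j \<in> {1..m}" for j
    \<comment> \<open>At \<open>j = m\<close> both factors are nonpositive: the cost drops after day
      \<open>m\<close>, and \<open>le\<close> reverses the comparison of tails.\<close>
    proof (cases "j = m")
      case True
      then show ?thesis using le decr by (simp add: mult_nonpos_nonpos)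
    next
      case False
      then show ?thesis using that ge[of j] incr[of j] by simp
    qed
    have "\<epsilon> * \<bar>?f (Suc i) - ?f i\<bar> \<le> \<bar>tail q i - tail p i\<bar> * \<bar>?f (Suc i) - ?f i\<bar>"
      using \<epsilon> by (intro mult_right_mono) auto
    also have "\<dots> = ?d i"
      using nonneg[of i] i by (simp flip: abs_mult)
    also have "\<dots> \<le> (\<Sum>j=1..m. ?d j)"
      using nonneg i by (intro member_le_sum) auto
    also have "\<dots> = measure_pmf.expectation q ?f - measure_pmf.expectation p ?f"
      by (rule expectation_diff_eq_sum_tail[OF q p_in_ski_strategies, symmetric])
        (simp add: ski_cost_eq)
    finally have "\<epsilon> * \<bar>?f (Suc i) - ?f i\<bar> \<le>
      measure_pmf.expectation q ?f - measure_pmf.expectation p ?f" .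
    moreover have "C * real m - t + max (t - real m) 0 * tail p m \<le> measure_pmf.expectation p ?f"
    proof -
      \<comment> \<open>Beyond day \<open>m\<close> the cost is \<open>m\<close>, and the first
        indicator restores the positive part exactly. The second one only fits the shape of
        \<open>expectation_add_indicators\<close>.\<close>
      let ?h = "\<lambda>x. ski_cost B m x - t + max (t - real m) 0 * indicator {m<..} x + 0 * indicator {} x"
      have "measure_pmf.expectation p ?h \<le> measure_pmf.expectation p ?f"
        by (intro integral_mono integrable_add_indicators integrable_ski_cost B)
          (auto simp: ski_cost_eq indicator_def)
      also have "measure_pmf.expectation p ?h = C * real m - t + max (t - real m) 0 * tail p m"
        unfolding expectation_add_indicators[OF integrable_ski_cost(1)[OF B]]
          expectation_p_ski_cost[OF m1] using m by (simp add: tail_def)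
      finally show ?thesis .
    qed
    moreover have "\<epsilon> * max (t - real m) 0 \<le> (tail p m - \<delta>) * max (t - real m) 0"
      using \<epsilon> by (intro mult_right_mono) auto
    moreover have "\<delta> * t \<le> \<delta> * (real m + max (t - real m) 0)"
      using \<delta> by (intro mult_left_mono) auto
    moreover have "\<epsilon> * 1 \<le> \<epsilon> * (\<bar>?f (Suc i) - ?f i\<bar> + max (t - real m) 0)"
    proof (intro mult_left_mono)
      \<comment> \<open>The increment has size at least 1 until \<open>t\<close> passes the smaller
        of the two costs, which is at least \<open>m\<close> because \<open>m < B\<close>. From
        there \<open>t - real m\<close> grows at least as fast as the increment shrinks.\<close>
      show "1 \<le> \<bar>?f (Suc i) - ?f i\<bar> + max (t - real m) 0"
        using i m by (cases "i = m") (auto simp: ski_cost_eq)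
    qed (use \<epsilon> in simp)
    ultimately show ?thesis by (simp add: algebra_simps)
  qed
  then have "((C - \<delta>) * real m + \<epsilon>) / (1 - \<delta>) \<le> cvar \<delta> q (ski_cost B m)"
    by (rule cvar_geI[OF \<delta>1])
  moreover have "(C - \<delta>) / (1 - \<delta>) * real m < ((C - \<delta>) * real m + \<epsilon>) / (1 - \<delta>)"
    using \<epsilon>(1) \<delta>1 by (simp add: divide_strict_right_mono)
  ultimately show ?thesis by simp
qed

lemma cvar_le_of_cvar_ratio_le:
  assumes "cvar_ratio B \<delta> q \<le> ereal a" "1 \<le> s"
  shows "cvar \<delta> q (ski_cost B s) \<le> a * real (min s B)"
proof -
  have "ereal (cvar \<delta> q (ski_cost B s) / real (min s B)) \<le> cvar_ratio B \<delta> q"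
    unfolding cvar_ratio_def using assms(2) by (intro SUP_upper) auto
  also note assms(1)
  finally show ?thesis using assms(2) B_ge_2 by (simp add: divide_le_eq)
qed

text \<open>At the first day \<open>j < B\<close> with a smaller tail, season \<open>j\<close> alone
  would exceed the ratio; from day \<open>B\<close> on the tail of \<open>p\<close> is 0.\<close>

lemma tail_p_le_tail:
  assumes "0 \<le> \<delta>" "\<delta> \<le> pmf p 1" "q \<in> ski_strategies"
    and ratio: "cvar_ratio B \<delta> q \<le> ereal ((C - \<delta>) / (1 - \<delta>))"
  shows "1 \<le> j \<Longrightarrow> tail p j \<le> tail q j"
proof (induction j rule: less_induct)
  case (less j)
  show ?case
  proof (cases "j < B")
    case True
    show ?thesis
    proof (rule ccontr)
      assume "\<not> tail p j \<le> tail q j"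
      then have "(C - \<delta>) / (1 - \<delta>) * real j < cvar \<delta> q (ski_cost B j)"
        using less True by (intro cvar_ski_cost_greater[where i = j] assms) auto
      with cvar_le_of_cvar_ratio_le[OF ratio less(2)] True show False by simp
    qed
  next
    case False
    then show ?thesis by (simp add: tail_p_eq_0 tail_nonneg)
  qed
qed

text \<open>In the season \<open>2 * B\<close> the cost dominates \<open>B - 1 + min x (B + 1)\<close>, which is monotone in the
  purchase day, so stochastic dominance over \<open>p\<close> gives the lower bound. The case \<open>k = 2\<close> is
  needed for the boundary value \<open>\<delta> = pmf p 1\<close>, where the threshold can rise
  from \<open>B\<close> to \<open>B + 1\<close> without loss.\<close>

lemma cvar_long_season_ge:
  assumes \<delta>: "0 \<le> \<delta>" "\<delta> \<le> pmf p 1" and q: "q \<in> ski_strategies"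
    and ge: "\<And>j. 1 \<le> j \<Longrightarrow> tail p j \<le> tail q j"
    and k: "k = 1 \<and> \<eta> = pmf p 1 - \<delta> \<or> k = 2 \<and> \<eta> = pmf p 2"
    and j: "k \<le> j" "j \<le> B"
  shows "((C - \<delta>) * real B + min \<eta> (tail q j - tail p j)) / (1 - \<delta>) \<le> cvar \<delta> q (ski_cost B (2 * B))"
proof (rule cvar_geI)
  show "\<delta> < 1" using \<delta> pmf_p_1_less_1 by simp
  fix t
  \<comment> \<open>The cap makes \<open>?g\<close> at most \<open>2 * B\<close>, the cost of not
    buying in this season, and it lies above every day used by \<open>p\<close>.\<close>
  let ?g = "\<lambda>x. real B - 1 + real (min x (Suc B))"
  let ?f = "\<lambda>x. max (?g x - t) 0"
  let ?\<epsilon> = "min \<eta> (tail q j - tail p j)"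
  have B: "1 \<le> B" using B_ge_2 by simp
  have j1: "1 \<le> j" using j k by auto
  have \<epsilon>: "0 \<le> ?\<epsilon>" using ge[OF j1] k \<delta> by auto
  have int_f: "integrable (measure_pmf q') ?f" for q'
    by (rule integrable_pmf_bounded[where K = "2 * real B + \<bar>t\<bar>"]) auto
  have int_g: "integrable (measure_pmf q') ?g" for q'
    by (rule integrable_pmf_bounded[where K = "2 * real B"]) (use B in auto)
  \<comment> \<open>Pure arithmetic over abstract reals: \<open>I\<close> is the increment of the
    excess at \<open>j\<close>, and \<open>M1\<close>, \<open>M2\<close> measure how far
    \<open>t\<close> exceeds \<open>B\<close> and \<open>B + 1\<close>.\<close>
  have combine: "(C - \<delta>) * real B + e \<le> (1 - \<delta>) * t + Es"
    if "d * I \<le> Eq - Ep" "Eq \<le> Es" "C * real B - t + M1 * p1 + M2 * p2 \<le> Ep" "e * I \<le> d * I"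
      "e * Mk \<le> (p1 - \<delta>) * M1 + p2 * M2" "\<delta> * t \<le> \<delta> * (real B + M1)" "e * 1 \<le> e * (I + Mk)"
    for d e I Ep Eq Es M1 M2 Mk p1 p2 :: real
    using that by (simp add: algebra_simps)
  let ?d = "\<lambda>i. (tail q i - tail p i) * (?f (Suc i) - ?f i)"
  have "?d j \<le> (\<Sum>i=1..B. ?d i)"
    using ge j j1 by (intro member_le_sum) auto
  also have "\<dots> = measure_pmf.expectation q ?f - measure_pmf.expectation p ?f"
    by (rule expectation_diff_eq_sum_tail[OF q p_in_ski_strategies, symmetric]) simp
  finally have "?d j \<le> measure_pmf.expectation q ?f - measure_pmf.expectation p ?f" .
  moreover have "measure_pmf.expectation q ?f
      \<le> (LINT x|measure_pmf q. max (ski_cost B (2 * B) x - t) 0)"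
    using int_f integrable_ski_cost[OF B] by (intro integral_mono) (auto simp: ski_cost_eq)
  \<comment> \<open>\<open>?g\<close> is \<open>B\<close> on day 1 and \<open>B + 1\<close> on day
    2, so these two atoms return what \<open>?g x - t\<close> loses below zero there.\<close>
  moreover have "C * real B - t + max (t - real B) 0 * pmf p 1 + max (t - real B - 1) 0 * pmf p 2
      \<le> measure_pmf.expectation p ?f"
  proof -
    have "measure_pmf.expectation p ?g = real B + (\<Sum>i=1..<Suc B. tail p i)"
    proof -
      have "measure_pmf.expectation p ?g = ?g 1 + (\<Sum>i=1..B. tail p i * (?g (Suc i) - ?g i))"
        by (rule expectation_eq_sum_tail[OF p_in_ski_strategies]) simp
      also have "(\<Sum>i=1..B. tail p i * (?g (Suc i) - ?g i)) = (\<Sum>i=1..<Suc B. tail p i)"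
        by (rule sum.cong) auto
      finally show ?thesis by simp
    qed
    then have "measure_pmf.expectation p ?g = C * real B"
      using sum_tail_p[of "Suc B"] by (simp add: tail_p_eq_0)
    moreover have "measure_pmf.expectation p (\<lambda>x. ?g x - t + max (t - real B) 0 * indicator {1} x
        + max (t - real B - 1) 0 * indicator {2} x) \<le> measure_pmf.expectation p ?f"
      by (intro integral_mono integrable_add_indicators int_g int_f) (auto simp: indicator_def)
    ultimately show ?thesis
      unfolding expectation_add_indicators[OF int_g] by (simp add: measure_pmf_single)
  qed
  moreover have "?\<epsilon> * (?f (Suc j) - ?f j) \<le> (tail q j - tail p j) * (?f (Suc j) - ?f j)"
    by (intro mult_right_mono) auto
  \<comment> \<open>\<open>real B + real k - 1\<close> is the value of \<open>?g\<close> at day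
    \<open>k\<close>. As \<open>k \<le> j\<close>, the increment at \<open>j\<close> shrinks only
    for \<open>t\<close> above this value.\<close>
  moreover have "?\<epsilon> * max (t - real B - real k + 1) 0
      \<le> (pmf p 1 - \<delta>) * max (t - real B) 0 + pmf p 2 * max (t - real B - 1) 0"
  proof -
    have "?\<epsilon> * max (t - real B - real k + 1) 0 \<le> \<eta> * max (t - real B - real k + 1) 0"
      by (intro mult_right_mono) auto
    moreover have "0 \<le> (pmf p 1 - \<delta>) * max (t - real B) 0" "0 \<le> pmf p 2 * max (t - real B - 1) 0"
      using \<delta> by auto
    moreover have "\<eta> * max (t - real B - real k + 1) 0 = (pmf p 1 - \<delta>) * max (t - real B) 0 \<or>
        \<eta> * max (t - real B - real k + 1) 0 = pmf p 2 * max (t - real B - 1) 0"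
    proof -
      have "t - real B - 1 + 1 = t - real B" "t - real B - 2 + 1 = t - real B - 1" by simp_all
      then show ?thesis
        using k by (elim disjE conjE) (simp_all only: of_nat_1 of_nat_numeral simp_thms)
    qed
    ultimately show ?thesis by linarith
  qed
  moreover have "\<delta> * t \<le> \<delta> * (real B + max (t - real B) 0)"
    using \<delta> by (intro mult_left_mono) auto
  moreover have "?\<epsilon> * 1 \<le> ?\<epsilon> * (?f (Suc j) - ?f j + max (t - real B - real k + 1) 0)"
    using \<epsilon> j by (intro mult_left_mono) auto
  ultimately show "(C - \<delta>) * real B + ?\<epsilon> \<le>
      (1 - \<delta>) * t + (LINT x|measure_pmf q. max (ski_cost B (2 * B) x - t) 0)"
    by (rule combine)
qed

section \<open>Optimal value and uniqueness\<close>

text \<open>A strictly better \<open>q\<close> would dominate \<open>p\<close> in all tails; but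
  then season \<open>2 * B\<close> already attains the ratio, the extra term for
  \<open>k = 1\<close> being nonnegative.\<close>

lemma cvar_ratio_ge:
  assumes \<delta>: "0 \<le> \<delta>" "\<delta> \<le> pmf p 1" and q: "q \<in> ski_strategies"
  shows "ereal ((C - \<delta>) / (1 - \<delta>)) \<le> cvar_ratio B \<delta> q"
proof (rule ccontr)
  assume "\<not> ereal ((C - \<delta>) / (1 - \<delta>)) \<le> cvar_ratio B \<delta> q"
  then have less: "cvar_ratio B \<delta> q < ereal ((C - \<delta>) / (1 - \<delta>))" by simp
  have \<delta>1: "\<delta> < 1" using \<delta> pmf_p_1_less_1 by simp
  have ge: "\<And>j. 1 \<le> j \<Longrightarrow> tail p j \<le> tail q j"
    using tail_p_le_tail[OF \<delta> q] less by simp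
  have "(C - \<delta>) * real B / (1 - \<delta>) \<le>
      ((C - \<delta>) * real B + min (pmf p 1 - \<delta>) (tail q 1 - tail p 1)) / (1 - \<delta>)"
    using \<delta> \<delta>1 ge[of 1] by (intro divide_right_mono) auto
  also have "\<dots> \<le> cvar \<delta> q (ski_cost B (2 * B))"
    using B_ge_2 by (intro cvar_long_season_ge[OF \<delta> q ge, where k = 1]) auto
  finally have "ereal ((C - \<delta>) / (1 - \<delta>)) \<le> ereal (cvar \<delta> q (ski_cost B (2 * B)) / real (min (2 * B) B))"
    using B_ge_2 by (simp add: le_divide_eq)
  also have "\<dots> \<le> cvar_ratio B \<delta> q"
    unfolding cvar_ratio_def using B_ge_2 by (intro SUP_upper) auto
  finally show False using less by simp
qed

text \<open>With \<open>\<eta>\<close> positive, any excess of the tail of \<open>q\<close> at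
  \<open>j\<close> would push season \<open>2 * B\<close> strictly above the ratio.\<close>

lemma tail_eq_tail_p:
  assumes \<delta>: "0 \<le> \<delta>" "\<delta> \<le> pmf p 1" and q: "q \<in> ski_strategies"
    and ratio: "cvar_ratio B \<delta> q \<le> ereal ((C - \<delta>) / (1 - \<delta>))"
    and k: "k = 1 \<and> \<eta> = pmf p 1 - \<delta> \<or> k = 2 \<and> \<eta> = pmf p 2" and "0 < \<eta>"
    and j: "k \<le> j" "j \<le> B"
  shows "tail q j = tail p j"
proof -
  have \<delta>1: "\<delta> < 1" using \<delta> pmf_p_1_less_1 by simp
  have ge: "\<And>j. 1 \<le> j \<Longrightarrow> tail p j \<le> tail q j"
    using tail_p_le_tail[OF \<delta> q ratio] by simp
  have "((C - \<delta>) * real B + min \<eta> (tail q j - tail p j)) / (1 - \<delta>) \<le> cvar \<delta> q (ski_cost B (2 * B))"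
    by (intro cvar_long_season_ge[OF \<delta> q ge k j])
  also have "\<dots> \<le> (C - \<delta>) / (1 - \<delta>) * real B"
    using cvar_le_of_cvar_ratio_le[OF ratio, of "2 * B"] B_ge_2 by simp
  finally have "min \<eta> (tail q j - tail p j) \<le> 0"
    using \<delta>1 by (simp add: divide_le_cancel)
  then have "tail q j \<le> tail p j" using \<open>0 < \<eta>\<close> by (simp add: min_le_iff_disj)
  then show ?thesis using ge[of j] j k by fastforce
qed

text \<open>For \<open>\<delta> < pmf p 1\<close> the case \<open>k = 1\<close> settles all days. At
  equality \<open>k = 2\<close> leaves day 1 open; season 2 decides it, and is a short season once
  \<open>B \<ge> 3\<close>.\<close>

lemma eq_p_of_cvar_ratio_le:
  assumes \<delta>: "0 \<le> \<delta>" "\<delta> \<le> pmf p 1" and q: "q \<in> ski_strategies"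
    and ratio: "cvar_ratio B \<delta> q \<le> ereal ((C - \<delta>) / (1 - \<delta>))"
    and "B \<ge> 3 \<or> \<delta> < pmf p 1"
  shows "q = p"
proof -
  have eq: "tail q j = tail p j" if j: "1 \<le> j" "j \<le> B" for j
  proof (cases "\<delta> < pmf p 1")
    case True
    then show ?thesis
      using j by (intro tail_eq_tail_p[OF \<delta> q ratio, where k = 1 and \<eta> = "pmf p 1 - \<delta>"]) auto
  next
    case False
    then have B3: "3 \<le> B" using assms(5) by simp
    have "0 < pmf p 2"
      using B3 C_pos r_pos by (simp add: pmf_p)
    then have eq2: "tail q j = tail p j" if "2 \<le> j" "j \<le> B" for j
      using that by (intro tail_eq_tail_p[OF \<delta> q ratio, where k = 2 and \<eta> = "pmf p 2"]) auto
    show ?thesis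
    proof (cases "j = 1")
      case True
      show ?thesis
      proof (rule ccontr)
        assume "tail q j \<noteq> tail p j"
        then have "(C - \<delta>) / (1 - \<delta>) * real 2 < cvar \<delta> q (ski_cost B 2)"
          using B3 eq2[of 2] True tail_p_le_tail[OF \<delta> q ratio]
          by (intro cvar_ski_cost_greater[where i = 1] \<delta> q) auto
        with cvar_le_of_cvar_ratio_le[OF ratio, of 2] B3 show False by (simp add: min_def)
      qed
    next
      case False
      then show ?thesis using eq2 j by simp
    qed
  qed
  show ?thesis
  proof (rule ski_strategies_eqI[OF q p_in_ski_strategies])
    fix j
    consider "j = 0" | "1 \<le> j" "j \<le> B" | "B < j" by linarith
    then show "tail q j = tail p j"
    proof cases
      case 1
      have "tail q 0 = 1"
        using q by (auto simp: tail_def measure_pmf.prob_eq_1 AE_measure_pmf_iff ski_strategies_def)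
      with 1 show ?thesis by (simp add: tail_p_0)
    next
      case 2
      then show ?thesis by (rule eq)
    next
      case 3
      then show ?thesis
        using tail_antimono[of B j q] tail_nonneg[of q j] eq[of B] B_ge_2 by (simp add: tail_p_eq_0)
    qed
  qed
qed

lemma opt_cvar_ratio_eq:
  assumes "0 \<le> \<delta>" "\<delta> \<le> pmf p 1"
  shows "opt_cvar_ratio B \<delta> = ereal ((C - \<delta>) / (1 - \<delta>))"
  unfolding opt_cvar_ratio_def
proof (rule antisym)
  show "(INF q\<in>ski_strategies. cvar_ratio B \<delta> q) \<le> ereal ((C - \<delta>) / (1 - \<delta>))"
    using p_in_ski_strategies cvar_ratio_p_le[OF assms] by (rule INF_lower2)
  show "ereal ((C - \<delta>) / (1 - \<delta>)) \<le> (INF q\<in>ski_strategies. cvar_ratio B \<delta> q)"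
    by (intro INF_greatest cvar_ratio_ge assms)
qed

lemma optimal_strategy_p:
  assumes "0 \<le> \<delta>" "\<delta> \<le> pmf p 1"
  shows "optimal_strategy B \<delta> p"
  unfolding optimal_strategy_def opt_cvar_ratio_eq[OF assms]
  using assms by (intro conjI antisym p_in_ski_strategies cvar_ratio_p_le cvar_ratio_ge)

lemma optimal_strategies_eq:
  assumes "0 \<le> \<delta>" "\<delta> \<le> pmf p 1" "B \<ge> 3 \<or> \<delta> < pmf p 1"
  shows "{q. optimal_strategy B \<delta> q} = {p}"
proof -
  have "q = p" if "optimal_strategy B \<delta> q" for q
    using that assms opt_cvar_ratio_eq[OF assms(1,2)]
    by (intro eq_p_of_cvar_ratio_le[of \<delta>]) (auto simp: optimal_strategy_def)
  then show ?thesis using optimal_strategy_p[OF assms(1,2)] by blast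
qed

end

section \<open>Existence of the strategy and conclusion\<close>

text \<open>The weights form a reversed geometric sum with total \<open>C * (1 - ?r ^ B)\<close>,
  which \<open>C\<close> normalizes to 1.\<close>

lemma ski_rental_pmf_exists:
  fixes B :: nat and C :: real
  assumes B: "2 \<le> B" and C: "C = 1 / (1 - (1 - 1 / real B) ^ B)"
  obtains p where "ski_rental B C p"
proof -
  let ?r = "1 - 1 / real B"
  let ?f = "\<lambda>i. if i \<in> {1..B} then C / real B * ?r ^ (B - i) else 0"
  have r: "0 < ?r" "?r < 1" using B by (simp_all add: field_simps)
  have rB: "?r ^ B < 1"
    using r B by (simp add: power_less_one_iff)
  have nonneg: "0 \<le> ?f i" for i
    using r rB by (simp add: C)
  have "(\<Sum>i\<in>{1..B}. ?f i) = C / real B * (\<Sum>i=1..B. ?r ^ (B - i))"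
    by (simp add: sum_distrib_left)
  also have "(\<Sum>i=1..B. ?r ^ (B - i)) = (\<Sum>i<B. ?r ^ i)"
    by (rule sum.reindex_bij_witness[of _ "\<lambda>i. B - i" "\<lambda>i. B - i"]) auto
  also have "C / real B * (\<Sum>i<B. ?r ^ i) = C * (1 - ?r ^ B)"
    using one_diff_power_eq[of ?r B] by simp
  also have "\<dots> = 1" using rB by (simp add: C)
  finally have sum: "(\<Sum>i\<in>{1..B}. ?f i) = 1" .
  have "(\<integral>\<^sup>+i. ennreal (?f i) \<partial>count_space UNIV) = (\<Sum>i\<in>{1..B}. ennreal (?f i))"
    by (rule nn_integral_count_space'[of "{1..B}"]) auto
  also have "\<dots> = ennreal (\<Sum>i\<in>{1..B}. ?f i)"
    using nonneg by (intro sum_ennreal)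
  finally have "(\<integral>\<^sup>+i. ennreal (?f i) \<partial>count_space UNIV) = 1"
    unfolding sum by simp
  then have "pmf (embed_pmf ?f) i = ?f i" for i
    using nonneg by (intro pmf_embed_pmf)
  then have "ski_rental B C (embed_pmf ?f)"
    using assms by unfold_locales
  then show thesis by (rule that)
qed

theorem theorem5:
  fixes B :: nat and \<delta> C \<delta>max :: real
  assumes "B \<ge> 2"
    and "C = 1 / (1 - (1 - 1 / real B) ^ B)"
    and "\<delta>max = ((real B - 1) / real B) ^ (B - 1) * (inverse (1 - (1 - 1 / real B) ^ B) / real B)"
    and "0 \<le> \<delta>" and "\<delta> \<le> \<delta>max"
  shows "opt_cvar_ratio B \<delta> = ereal ((C - \<delta>) / (1 - \<delta>)) \<and>
    (\<exists>p :: nat pmf.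
       (\<forall>i. pmf p i = (if i \<in> {1..B} then C / real B * (1 - 1 / real B) ^ (B - i) else 0)) \<and>
       optimal_strategy B \<delta> p \<and>
       (B \<ge> 3 \<or> \<delta> < \<delta>max \<longrightarrow> {q. optimal_strategy B \<delta> q} = {p}) \<and>
       {q. optimal_strategy B 0 q} = {p})"
proof -
  obtain p where "ski_rental B C p"
    using ski_rental_pmf_exists[OF assms(1,2)] by blast
  then interpret ski_rental B C p .
  have "1 - 1 / real B = (real B - 1) / real B"
    using assms(1) by (simp add: field_simps)
  \<comment> \<open>The admissible range of \<open>\<delta>\<close> ends exactly at the day-1
    atom.\<close>
  then have \<delta>max: "\<delta>max = pmf p 1"
    using assms(1,2,3) pmf_p[of 1] by (simp add: divide_inverse mult_ac)
  \<comment> \<open>Uniqueness at \<open>\<delta> = 0\<close> thus falls under the strict case, also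
    for \<open>B = 2\<close>.\<close>
  have "0 < pmf p 1"
    using assms(1) C_pos r_pos by (simp add: pmf_p)
  with assms(4,5) show ?thesis
    unfolding \<delta>max
    by (intro conjI impI exI[of _ p] allI pmf_p opt_cvar_ratio_eq optimal_strategy_p
        optimal_strategies_eq) auto
qed

end
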